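(* Let $f\colon\mathbb{C}\to\mathbb{C}$ be an SD map with $f(\mathbb{R})\subseteq\mathbb{R}$. Then $f(z)=z$ for all $z\in\mathbb{C}$, or $f(z)=\overline{z}$ for all $z\in\mathbb{C}$.
   Context: An SD map on a field $\mathbb{F}$ is a function $f\colon \mathbb{F}\to\mathbb{F}$ such that for all $x \neq y$ in $\mathbb{F}$ one has $f(x)\neq f(y)$ and $f\left(\frac{x+y}{x-y}\right) = \frac{f(x)+f(y)}{f(x)-f(y)}$. No continuity is assumed. *)

theory Defs
  imports Complex_Main
begin

text \<open>Both quotients have nonzero denominators, since \<open>x \<noteq> y\<close> and \<open>f x \<noteq> f y\<close>; the convention
  \<open>a / 0 = 0\<close> plays no role.\<close>

definition SD_map :: "('a::field \<Rightarrow> 'a) \<Rightarrow> bool" where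
  "SD_map f \<longleftrightarrow>
     (\<forall>x y. x \<noteq> y \<longrightarrow> f x \<noteq> f y \<and> f ((x + y) / (x - y)) = (f x + f y) / (f x - f y))"

end

(* Putting y = 0 gives f 0 = 0 and f 1 = 1.  As (x+y)/(x-y) depends only on x/y and
   t |-> (t+1)/(t-1) is an involution, comparing the equation for (x, y) with the one for
   (x/y, 1) shows that f is multiplicative.  On the reals f preserves positivity (squares),
   hence order; computing f 6 in two ways forces (f 2 - 2)((f 2)^2 + 1) = 0, so f 2 = 2, f fixes
   the rationals and, by monotonicity, the reals.  Finally f \<i> = s with s^2 = -1, and every
   complex number is w^2 = |w|^2 * (p + iq)/(p - iq) with w = p + iq, so the equation for
   (p, iq) determines f (w^2). *)
theory Submission
  imports Defs
begin

section \<open>Algebraic consequences of the SD equation\<close>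

lemma SD_map_inj: "SD_map f \<Longrightarrow> f x = f y \<longleftrightarrow> x = y"
  unfolding SD_map_def by metis

lemma SD_map_eq: "SD_map f \<Longrightarrow> x \<noteq> y \<Longrightarrow> f ((x + y) / (x - y)) = (f x + f y) / (f x - f y)"
  unfolding SD_map_def by metis

text \<open>With y = 0 the SD equation is linear in \<open>f x\<close>. Subtracting its instances at
  1 and 2, which differ in characteristic 0, isolates \<open>f 1\<close>; the instance at 1 then
  gives \<open>f 0\<close>.\<close>

lemma SD_map_0_1:
  fixes f :: "'a::field_char_0 \<Rightarrow> 'a"
  assumes "SD_map f"
  shows "f 0 = 0" "f 1 = 1"
proof -
  have eq: "f 1 * (f x - f 0) = f x + f 0" if "x \<noteq> 0" for x
  proof -
    have "f x - f 0 \<noteq> 0"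
      using SD_map_inj[OF assms] that by simp
    then show ?thesis
      using SD_map_eq[OF assms that] that by (simp add: field_simps)
  qed
  have "f 1 * (f 1 - f 2) = f 1 - f 2"
    using eq[of 1] eq[of 2] by (simp add: algebra_simps)
  moreover have "f 1 - f 2 \<noteq> 0"
    using SD_map_inj[OF assms, of 1 2] by simp
  ultimately show f1: "f 1 = 1"
    by simp
  then have "2 * f 0 = 0"
    using eq[of 1] by (simp add: algebra_simps)
  then show "f 0 = 0"
    by simp
qed

lemma SD_map_minus:
  fixes f :: "'a::field_char_0 \<Rightarrow> 'a"
  assumes "SD_map f"
  shows "f (- x) = - f x"
proof (cases "x = 0")
  case False
  then have "x \<noteq> - x"
    by (simp add: eq_neg_iff_add_eq_0 flip: mult_2)
  \<comment> \<open>The pair (x, -x) has sum 0, and \<open>f 0 = 0\<close> makes the numerator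
    vanish.\<close>
  then have "f x - f (- x) \<noteq> 0" "0 = (f x + f (- x)) / (f x - f (- x))"
    using SD_map_eq[OF assms \<open>x \<noteq> - x\<close>] SD_map_inj[OF assms, of x "- x"]
    by (auto simp: SD_map_0_1[OF assms])
  then show ?thesis
    by (simp add: add_eq_0_iff)
qed (simp add: SD_map_0_1[OF assms])

lemma SD_map_divide:
  fixes f :: "'a::field_char_0 \<Rightarrow> 'a"
  assumes "SD_map f"
  shows "f (x / y) = f x / f y"
proof -
  note f01 = SD_map_0_1[OF assms]
  consider "y = 0" | "y \<noteq> 0" "x = y" | "y \<noteq> 0" "x \<noteq> y"
    by blast
  then show ?thesis
  proof cases
    case 3
    define u where "u = f (x / y)"
    have "x / y \<noteq> 1"
      using 3 by simp
    then have u: "u - 1 \<noteq> 0"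
      using SD_map_inj[OF assms, of "x / y" 1] by (simp add: u_def f01)
    have d: "f x - f y \<noteq> 0" "f y \<noteq> 0"
      using 3 SD_map_inj[OF assms, of x y] SD_map_inj[OF assms, of y 0] by (auto simp: f01)
    have "(x / y + 1) / (x / y - 1) = (x + y) / (x - y)"
      using 3 by (simp add: divide_simps)
    then have "(u + 1) / (u - 1) = (f x + f y) / (f x - f y)"
      using SD_map_eq[OF assms \<open>x / y \<noteq> 1\<close>] SD_map_eq[OF assms \<open>x \<noteq> y\<close>]
      by (simp add: u_def f01)
    then have "(u + 1) * (f x - f y) = (f x + f y) * (u - 1)"
      using u d by (simp add: frac_eq_eq)
    \<comment> \<open>Cross-multiplying shows that u |-> (u + 1) / (u - 1) is injective, which
      identifies \<open>u\<close> with \<open>f x / f y\<close>.\<close>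
    then have "2 * (u * f y) = 2 * f x"
      by (simp add: algebra_simps)
    then show ?thesis
      using d unfolding u_def by (simp add: eq_divide_eq)
  \<comment> \<open>For \<open>y = 0\<close> both sides are 0 by the convention for division by
    zero.\<close>
  qed (use SD_map_inj[OF assms, of y 0] in \<open>auto simp: f01\<close>)
qed

lemma SD_map_mult:
  fixes f :: "'a::field_char_0 \<Rightarrow> 'a"
  assumes "SD_map f"
  shows "f (x * y) = f x * f y"
  using SD_map_divide[OF assms, of x "1 / y"] SD_map_divide[OF assms, of 1 y]
  by (simp add: SD_map_0_1[OF assms])

text \<open>Multiplicativity splits the SD quotient. With \<open>y = 1\<close> this becomes a
  recurrence between values at neighbouring integers.\<close>

lemma SD_map_mult_diff:
  fixes f :: "'a::field_char_0 \<Rightarrow> 'a"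
  assumes "SD_map f" "x \<noteq> y"
  shows "f (x + y) * (f x - f y) = (f x + f y) * f (x - y)"
proof -
  have "f x - f y \<noteq> 0" "f (x - y) \<noteq> 0"
    using assms SD_map_inj[OF assms(1), of x y] SD_map_inj[OF assms(1), of "x - y" 0]
    by (auto simp: SD_map_0_1)
  then show ?thesis
    using SD_map_eq[OF assms] by (simp add: SD_map_divide[OF assms(1)] frac_eq_eq)
qed

section \<open>SD maps on the reals\<close>

lemma SD_map_real_strict_mono:
  fixes g :: "real \<Rightarrow> real"
  assumes "SD_map g"
  shows "strict_mono g"
proof -
  have pos: "g x > 0" if "x > 0" for x
  proof -
    have "g x = g (sqrt x) * g (sqrt x)"
      using that by (simp flip: SD_map_mult[OF assms])
    moreover have "g x \<noteq> 0"
      using SD_map_inj[OF assms, of x 0] that by (simp add: SD_map_0_1[OF assms])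
    ultimately show ?thesis
      by (metis not_real_square_gt_zero mult_zero_left)
  qed
  \<comment> \<open>The quotient (x + y) / (x - y) is positive, hence so is its image; as
    \<open>g x + g y\<close> is positive, so is \<open>g x - g y\<close>. Oddness later covers the
    remaining signs.\<close>
  have less: "g y < g x" if "0 < y" "y < x" for x y
  proof -
    have "0 < g (x + y) / g (x - y)"
      using that by (simp add: pos)
    also have "\<dots> = (g x + g y) / (g x - g y)"
      using SD_map_eq[OF assms, of x y] that by (simp add: SD_map_divide[OF assms])
    finally show ?thesis
      using pos[of x] pos[of y] that by (simp add: zero_less_divide_iff)
  qed
  show ?thesis
  proof (rule strict_monoI)
    fix y x :: real assume "y < x"
    consider "0 < y" | "y \<le> 0" "0 < x" | "y < 0" "x \<le> 0"
      using \<open>y < x\<close> by linarith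
    then show "g y < g x"
    proof cases
      case 1
      then show ?thesis using less \<open>y < x\<close> by simp
    next
      case 2
      then show ?thesis
        using pos[of x] pos[of "- y"]
        by (cases "y = 0") (auto simp: SD_map_0_1[OF assms] SD_map_minus[OF assms])
    next
      case 3
      then show ?thesis
        using less[of "- x" "- y"] pos[of "- y"] \<open>y < x\<close>
        by (cases "x = 0") (auto simp: SD_map_0_1[OF assms] SD_map_minus[OF assms])
    qed
  qed
qed

lemma SD_map_real_2:
  fixes g :: "real \<Rightarrow> real"
  assumes "SD_map g"
  shows "g 2 = 2"
proof -
  define a b c where "a = g 2" and "b = g 3" and "c = g 5"
  note g1 = SD_map_0_1(2)[OF assms]
  have "a > 1"
    using strict_monoD[OF SD_map_real_strict_mono[OF assms], of 1 2] by (simp add: a_def g1)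
  have g4: "g 4 = a * a" and g6: "g 6 = b * a"
    unfolding a_def b_def by (simp_all flip: SD_map_mult[OF assms])
  have b: "b * (a - 1) = a + 1"
    using SD_map_mult_diff[OF assms, of 2 1] by (simp add: a_def b_def g1)
  have "c * (a * a - 1) = (a * a + 1) * b"
    using SD_map_mult_diff[OF assms, of 4 1] by (simp add: b_def c_def g4 g1)
  then have "c * (a * a - 1) * (a - 1) = (a * a + 1) * (b * (a - 1))"
    by (metis mult.assoc)
  \<comment> \<open>Here \<open>b\<close> is eliminated, and \<open>a * a - 1\<close> contributes
    the factor \<open>a + 1\<close> that cancels next.\<close>
  then have "c * ((a - 1) * (a - 1)) * (a + 1) = (a * a + 1) * (a + 1)"
    unfolding b by algebra
  then have "c * ((a - 1) * (a - 1)) = a * a + 1"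
    using \<open>a > 1\<close> by simp
  \<comment> \<open>Subtracting or adding (a - 1)^2 gives \<open>c - 1\<close> and
    \<open>c + 1\<close> up to the same factor, so that their ratio is free of
    \<open>c\<close>.\<close>
  then have c: "(c - 1) * ((a - 1) * (a - 1)) = 2 * a"
    "(c + 1) * ((a - 1) * (a - 1)) = 2 * (a * a - a + 1)"
    by algebra+
  \<comment> \<open>The second computation of \<open>g 6\<close>: the pair (5, 1) has sum 6 and
    difference 4, while \<open>g6\<close> came from 6 = 3 * 2.\<close>
  have "b * a * (c - 1) = (c + 1) * (a * a)"
    using SD_map_mult_diff[OF assms, of 5 1] by (simp add: c_def g6 g4 g1)
  then have "b * (c - 1) = (c + 1) * a"
    using \<open>a > 1\<close> by simp
  then have "b * ((c - 1) * ((a - 1) * (a - 1))) = (c + 1) * ((a - 1) * (a - 1)) * a"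
    by algebra
  then have "b * (2 * a) = 2 * (a * a - a + 1) * a"
    unfolding c .
  then have "b = a * a - a + 1"
    using \<open>a > 1\<close> by simp
  then have "(a * a - a + 1) * (a - 1) = a + 1"
    using b by simp
  then have "(a - 2) * (a * a + 1) = 0"
    by (simp add: algebra_simps)
  moreover have "a * a + 1 > 0"
    by (simp add: add_nonneg_pos)
  ultimately show ?thesis
    by (simp add: a_def)
qed

text \<open>The pair (n - 1, 1) determines \<open>g n\<close> from the two preceding values. For n =
  2 that pair degenerates to (1, 1), so \<open>g 2\<close> has to be known beforehand.\<close>

lemma SD_map_real_of_nat:
  fixes g :: "real \<Rightarrow> real"
  assumes "SD_map g"
  shows "g (real n) = real n"
proof (induction n rule: less_induct)
  case (less n)
  consider "n = 0" | "n = 1" | "n = 2" | "3 \<le> n"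
    by linarith
  then show ?case
  proof cases
    case 4
    then obtain m where n: "n = m + 3"
      by (metis le_iff_add add.commute)
    have IH: "g (real (m + 2)) = real (m + 2)" "g (real (m + 1)) = real (m + 1)"
      using n by (intro less; linarith)+
    have "g (real (m + 2) + 1) * (g (real (m + 2)) - 1)
        = (g (real (m + 2)) + 1) * g (real (m + 1))"
      using SD_map_mult_diff[OF assms, of "real (m + 2)" 1]
      by (simp add: SD_map_0_1[OF assms] algebra_simps)
    then have "g (real n) * (real m + 1) = (real m + 3) * (real m + 1)"
      unfolding IH by (simp add: n algebra_simps)
    moreover have "real m + 1 \<noteq> 0"
      by linarith
    ultimately show ?thesis
      using n by simp
  qed (simp_all add: SD_map_0_1[OF assms] SD_map_real_2[OF assms])
qed

lemma SD_map_real_of_rat: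
  fixes g :: "real \<Rightarrow> real"
  assumes "SD_map g" "q \<in> \<rat>"
  shows "g q = q"
proof -
  obtain m n where q: "\<bar>q\<bar> = real m / real n"
    using Rats_abs_nat_div_natE[OF assms(2)] by metis
  have "g \<bar>q\<bar> = \<bar>q\<bar>"
    unfolding q SD_map_divide[OF assms(1)] SD_map_real_of_nat[OF assms(1)] ..
  then show ?thesis
    by (auto simp: abs_if SD_map_minus[OF assms(1)] split: if_splits)
qed

text \<open>A rational strictly between \<open>x\<close> and \<open>g x\<close> would be fixed,
  against monotonicity.\<close>

lemma SD_map_real_id:
  fixes g :: "real \<Rightarrow> real"
  assumes "SD_map g"
  shows "g x = x"
proof (rule ccontr)
  note mono = strict_mono_less[OF SD_map_real_strict_mono[OF assms]]
  assume "g x \<noteq> x"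
  then consider "g x < x" | "x < g x"
    by linarith
  then show False
  proof cases
    case 1
    then obtain q where "q \<in> \<rat>" "g x < q" "q < x"
      using Rats_dense_in_real by blast
    then show False
      using mono[of q x] SD_map_real_of_rat[OF assms, of q] by simp
  next
    case 2
    then obtain q where "q \<in> \<rat>" "x < q" "q < g x"
      using Rats_dense_in_real by blast
    then show False
      using mono[of x q] SD_map_real_of_rat[OF assms, of q] by simp
  qed
qed

section \<open>Complex SD maps preserving the reals\<close>

lemma SD_map_complex_of_real:
  fixes f :: "complex \<Rightarrow> complex"
  assumes "SD_map f" "f ` \<real> \<subseteq> \<real>"
  shows "f (complex_of_real x) = complex_of_real x"
proof -
  \<comment> \<open>\<open>Re\<close> only changes the type: \<open>f\<close> is real on the reals,
    so no information is lost.\<close>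
  define g where "g = (\<lambda>x. Re (f (complex_of_real x)))"
  have fg: "f (complex_of_real x) = complex_of_real (g x)" for x
    using assms(2) unfolding g_def by (simp add: image_subset_iff)
  have "SD_map g"
    unfolding SD_map_def
  proof (intro allI impI conjI)
    fix x y :: real assume "x \<noteq> y"
    then show "g x \<noteq> g y"
      using SD_map_inj[OF assms(1), of x y] by (auto simp: fg)
    have "complex_of_real (g ((x + y) / (x - y))) = complex_of_real ((g x + g y) / (g x - g y))"
      using SD_map_eq[OF assms(1), of x y] \<open>x \<noteq> y\<close> by (simp flip: fg)
    then show "g ((x + y) / (x - y)) = (g x + g y) / (g x - g y)"
      using of_real_eq_iff by blast
  qed
  then show ?thesis
    by (simp add: fg SD_map_real_id)
qed

theorem theorem4p4:
  fixes f :: "complex \<Rightarrow> complex"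
  assumes "SD_map f"
    and "f ` \<real> \<subseteq> \<real>"
  shows "(\<forall>z. f z = z) \<or> (\<forall>z. f z = cnj z)"
proof -
  note f_real = SD_map_complex_of_real[OF assms]
  define s where "s = f \<i>"
  have "s\<^sup>2 = f (complex_of_real (- 1))"
    unfolding s_def power2_eq_square by (simp flip: SD_map_mult[OF assms(1)])
  then have s2: "s\<^sup>2 = - 1"
    unfolding f_real by simp
  have sq: "f (w\<^sup>2) = (Re w + Im w * s)\<^sup>2" for w
  proof (cases "w = 0")
    case False
    define p q where "p = Re w" and "q = Im w"
    define d where "d = complex_of_real (p\<^sup>2 + q\<^sup>2)"
    have w: "w = p + q * \<i>"
      by (simp add: p_def q_def complex_eq_iff)
    have "p\<^sup>2 + q\<^sup>2 \<noteq> 0"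
      using False by (auto simp: w sum_power2_eq_zero_iff)
    then have "d \<noteq> 0"
      unfolding d_def by (simp only: of_real_eq_0_iff not_False_eq_True)
    \<comment> \<open>A general root \<open>r\<close> of -1 lets the same identities serve for \<i>
      in the argument and for \<open>s\<close> in the value.\<close>
    have d: "(p + q * r) * (p - q * r) = d" if "r\<^sup>2 = - 1" for r :: complex
    proof -
      have "(p + q * r) * (p - q * r) = (of_real p)\<^sup>2 - (of_real q)\<^sup>2 * r\<^sup>2"
        by (simp add: algebra_simps power2_eq_square)
      then show ?thesis
        by (simp add: that d_def)
    qed
    have w2: "d * ((p + q * r) / (p - q * r)) = (p + q * r)\<^sup>2" if "r\<^sup>2 = - 1" for r :: complex
    proof -
      have "p - q * r \<noteq> 0"
        using d[OF that] \<open>d \<noteq> 0\<close> by auto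
      then show ?thesis
        unfolding d[OF that, symmetric] by (simp add: power2_eq_square)
    qed
    have "p - q * \<i> \<noteq> 0"
      using d[of \<i>] \<open>d \<noteq> 0\<close> by auto
    then have "f ((p + q * \<i>) / (p - q * \<i>)) = (p + q * s) / (p - q * s)"
      using SD_map_eq[OF assms(1), of p "q * \<i>"]
      by (simp add: SD_map_mult[OF assms(1)] f_real s_def)
    \<comment> \<open>The factor \<open>d\<close> is real, hence fixed, and comes out by
      multiplicativity.\<close>
    then have "f (d * ((p + q * \<i>) / (p - q * \<i>))) = d * ((p + q * s) / (p - q * s))"
      unfolding SD_map_mult[OF assms(1)] by (simp add: d_def f_real del: of_real_add)
    then show ?thesis
      using w2[OF s2] w2[of \<i>] by (simp add: w)
  qed (simp add: SD_map_0_1[OF assms(1)])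
  have "(s - \<i>) * (s + \<i>) = 0"
    using s2 by (simp add: algebra_simps power2_eq_square)
  then consider "s = \<i>" | "s = - \<i>"
    by (auto simp: eq_neg_iff_add_eq_0)
  then show ?thesis
  proof cases
    case 1
    then have "f (w\<^sup>2) = w\<^sup>2" for w
      using sq[of w] by (simp add: mult.commute flip: complex_eq)
    then show ?thesis
      \<comment> \<open>Every complex number is a square, so the formula on squares covers all of
        them.\<close>
      by (metis power2_csqrt)
  next
    case 2
    have "complex_of_real (Re w) + Im w * (- \<i>) = cnj w" for w
      by (simp add: complex_eq_iff)
    then have "f (w\<^sup>2) = cnj (w\<^sup>2)" for w
      using sq[of w] by (simp add: 2)
    then show ?thesis
      by (metis power2_csqrt)
  qed
qed

end
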